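(* Let $n>k\geq 2$. If a central generic arrangement $\mathcal{A}^0$ of $n$ hyperplanes in $\mathbb{C}^k$ is $(r,s)$-dependent for some $s>1$, then the discriminantal arrangement $\mathcal{B}(n,k,\mathcal{A}^0)$ admits a simple intersection $X$ of multiplicity $r$ and $\operatorname{rank} X<r$.
   Context: **Central generic arrangements and translates.** Write $[n]=\{1,\ldots,n\}$. A central generic arrangement in $\mathbb{C}^k$ is a central arrangement $\mathcal{A}^0=\{H_1^0,\ldots,H_n^0\}$ of $n>k$ hyperplanes such that, for every $m\le k$, any $m$ of the hyperplanes intersect in codimension $m$ at any point except for the origin (so any $k$ of them meet only in the origin). A translated (arrangement) of $\mathcal{A}^0$ is an arrangement $\mathcal{A}=\{H_1,\ldots,H_n\}$ of parallel translates, i.e. for each $i$ either $H_i\cap H_i^0=\emptyset$ or $H_i=H_i^0$. The space of all such $n$-tuples of translates is identified with $\mathbb{C}^n$, with $(H_1^0,\ldots,H_n^0)$ corresponding to the origin. **Discriminantal arrangement.** For $L\subset[n]$ with $|L|=k+1$, let $D_L\subset\mathbb{C}^n$ be the hyperplane of all translates $\mathcal{A}$ in which the hyperplanes $H_p$, $p\in L$, fail to form a generic arrangement, i.e. $\bigcap_{p\in L}H_p\neq\emptyset$. The discriminantal arrangement $\mathcal{B}(n,k,\mathcal{A}^0)$ is the arrangement in $\mathbb{C}^n$ of all these hyperplanes $D_L$. Its intersection lattice is the set of all intersections of the hyperplanes $D_L$; the rank of an element is its codimension in $\mathbb{C}^n$. For $S\subset[n]$ with $|S|\ge k+1$ put $D_S=\bigcap_{L\subset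 S,\,|L|=k+1}D_L$, the space of all translates whose hyperplanes indexed by $S$ have nonempty common intersection. **Simple intersections.** An element $X$ of the intersection lattice of $\mathcal{B}(n,k,\mathcal{A}^0)$ is a simple intersection if $X=\bigcap_{i=1}^rD_{L_i}$ with $|L_i|=k+1$, and $\bigcap_{i\in I}D_{L_i}\neq D_S$, $|S|>k+1$, for any $I\subset[r]$ with $|I|\ge2$ (that is, no such partial intersection equals a $D_S$ with $|S|>k+1$). The number $r$ of the hyperplanes intersecting in $X$ is called the multiplicity of the simple intersection $X$. **$r$-sets.** An $r$-set is a set $\mathbb{T}=\{L_1,\ldots,L_r\}$ of subsets $L_i\subset[n]$ with $|L_i|=k+1$, such that $\bigcup_{i=1}^rL_i=\bigcup_{i\in I}L_i$ for every $I\subset[r]$ with $|I|=r-1$, and $L_i\cap L_j\neq\emptyset$ for all $1\le i<j\le r$. **$K_{\mathbb{T}}$-translated and $K_{\mathbb{T}}$-configuration.** Given an $r$-set $\mathbb{T}$, a translated $\mathcal{A}=\{H_1,\ldots,H_n\}$ of $\mathcal{A}^0$ is called $K_{\mathbb{T}}$, or $K_{\mathbb{T}}$-translated, if $\bigcap_{p\in L_i}H_p\neq\emptyset$ and $\bigcap_{p\in L_i\cup\{t\}}H_p=\emptyset$ for any $i\in[r]$ and $t\notin L_i$. The complete graph having the points $P_i=\bigcap_{p\in L_i}H_p$ as vertices and the vectors $P_iP_j$ joining $P_i$ and $P_j$ as edges is called the $K_{\mathbb{T}}$-configuration, denoted $K_{\mathbb{T}}(\mathcal{A})$. **Almost $K_{\mathbb{T}}$-translated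 and almost $K_{\mathbb{T}}$-configuration.** A translated $\mathcal{A}$ of $\mathcal{A}^0$ is called almost $K_{\mathbb{T}}$ (almost $K_{\mathbb{T}}$-translated) if it is $K_{\mathbb{T}}$ but for one hyperplane $H_l$ and a set $S_l$, i.e. if there exist a hyperplane $H_l\in\mathcal{A}$, $l\in\bigcup_{i=1}^rL_i\setminus\bigcap_{i=1}^rL_i$, and a set $S_l\subseteq\{L_i\in\mathbb{T}: l\in L_i\}$ such that $\bigcap_{p\in L_j}H_p\neq\emptyset$ for any $L_j\in\mathbb{T}\setminus S_l$ and $\bigcap_{p\in L_i}H_p=\emptyset$ for any $L_i\in S_l$. Putting $P_i=\bigcap_{p\in L_i\setminus\{l\}}H_p$ for $L_i\in S_l$ and $P_i=\bigcap_{p\in L_i}H_p$ for $L_i\notin S_l$, the complete graph having the $P_i$ as vertices and the $P_iP_j$ as edges is called the almost $K_{\mathbb{T}}$-configuration, denoted $K_{\mathbb{T}\setminus S_l}(\mathcal{A})$. **$(r,s)$-dependency.** A central generic arrangement $\mathcal{A}^0$ of $n$ hyperplanes in $\mathbb{C}^k$ is called $(r,s)$-dependent if there exist an $r$-set $\mathbb{T}=\{L_1,\ldots,L_r\}$, an index $l\in\bigcup_{i=1}^rL_i\setminus\bigcap_{i=1}^rL_i$ and a subset $S_l\subseteq\{L_i\in\mathbb{T}: l\in L_i\}$ with $|S_l|=s$, such that any almost $K_{\mathbb{T}}$-configuration $K_{\mathbb{T}\setminus S_l}(\mathcal{A})$ gives rise to a $K_{\mathbb{T}}$-configuration $K_{\mathbb{T}}(\mathcal{A}')$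 with the $K_{\mathbb{T}}$-translated $\mathcal{A}'$ obtained from the almost $K_{\mathbb{T}}$-translated $\mathcal{A}$ by a suitable translation of the hyperplane $H_l\in\mathcal{A}$.
   Formalization: Dependency also requires that an almost K_T-configuration exists (vacuous dependency makes the claim false, e.g. k=2, n=4, all four triples), and almost K_T-translates are required to have no hyperplane H_t, t not in L_i, through the vertex P_i. *)

theory Defs
  imports "HOL-Analysis.Analysis"
begin

text \<open>
  The index set \<open>[n]\<close> is the finite type \<^typ>\<open>'n\<close> and the coordinates of \<open>\<complex>\<^sup>k\<close> are indexed by
  the finite type \<^typ>\<open>'k\<close>. An arrangement is given by normal vectors \<open>\<alpha> p\<close> of its
  hyperplanes. Choosing normals identifies the space of all translates with \<open>\<complex>\<^sup>n\<close>:
  the translate \<open>b\<close> consists of the hyperplanes \<open>\<alpha> p \<cdot> x = b $ p\<close>, and \<open>b = 0\<close> is the central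
  arrangement. Rescaling a normal rescales a coordinate of \<open>\<complex>\<^sup>n\<close>.
  Dimensions are over the complex numbers (\<^const>\<open>vec.dim\<close>), not over the reals.
\<close>

definition hyp :: "('n \<Rightarrow> complex^'k) \<Rightarrow> complex^'n \<Rightarrow> 'n \<Rightarrow> (complex^'k) set" where
  "hyp \<alpha> b p = {x. (\<Sum>j\<in>UNIV. \<alpha> p $ j * x $ j) = b $ p}"

definition central_generic :: "('n::finite \<Rightarrow> complex^'k) \<Rightarrow> bool" where
  "central_generic \<alpha> \<longleftrightarrow>
     CARD('n) > CARD('k) \<and>
     (\<forall>p. \<alpha> p \<noteq> 0) \<and>
     (\<forall>M. card M \<le> CARD('k) \<longrightarrow>
        vec.dim (\<Inter>p\<in>M. hyp \<alpha> 0 p) = CARD('k) - card M)"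

subsection \<open>The discriminantal arrangement\<close>

definition D :: "('n \<Rightarrow> complex^'k) \<Rightarrow> 'n set \<Rightarrow> (complex^'n) set" where
  "D \<alpha> L = {b. (\<Inter>p\<in>L. hyp \<alpha> b p) \<noteq> {}}"

definition DS :: "('n \<Rightarrow> complex^'k) \<Rightarrow> 'n set \<Rightarrow> (complex^'n) set" where
  "DS \<alpha> S = (\<Inter>L\<in>{L. L \<subseteq> S \<and> card L = CARD('k) + 1}. D \<alpha> L)"

definition discriminantal :: "('n \<Rightarrow> complex^'k) \<Rightarrow> (complex^'n) set set" where
  "discriminantal \<alpha> = {D \<alpha> L | L. card L = CARD('k) + 1}"

definition intersection_lattice :: "(complex^'n) set set \<Rightarrow> (complex^'n) set set" where
  "intersection_lattice B = {\<Inter>F | F. F \<subseteq> B}"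

definition rank_of :: "(complex^'n::finite) set \<Rightarrow> nat" where
  "rank_of X = CARD('n) - vec.dim X"

text \<open>The multiplicity \<open>r\<close> is the number of (pairwise distinct) hyperplanes in the presentation
  of \<open>X\<close>; \<open>X\<close> may lie on further hyperplanes of the arrangement.\<close>

definition simple_intersection ::
    "('n::finite \<Rightarrow> complex^'k) \<Rightarrow> nat \<Rightarrow> (complex^'n) set \<Rightarrow> bool" where
  "simple_intersection \<alpha> r X \<longleftrightarrow>
     X \<in> intersection_lattice (discriminantal \<alpha>) \<and>
     (\<exists>T. card T = r \<and> (\<forall>L\<in>T. card L = CARD('k) + 1) \<and>
        X = (\<Inter>L\<in>T. D \<alpha> L) \<and>
        (\<forall>I S. I \<subseteq> T \<and> card I \<ge> 2 \<and> card S > CARD('k) + 1 \<longrightarrow>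
           (\<Inter>L\<in>I. D \<alpha> L) \<noteq> DS \<alpha> S))"

subsection \<open>Dependency\<close>

definition r_set :: "nat \<Rightarrow> nat \<Rightarrow> 'n::finite set set \<Rightarrow> bool" where
  "r_set k r T \<longleftrightarrow>
     card T = r \<and> (\<forall>L\<in>T. card L = k + 1) \<and>
     (\<forall>U. U \<subseteq> T \<and> card U = r - 1 \<longrightarrow> \<Union>T = \<Union>U) \<and>
     (\<forall>L\<in>T. \<forall>L'\<in>T. L \<noteq> L' \<longrightarrow> L \<inter> L' \<noteq> {})"

definition KT_translated :: "('n \<Rightarrow> complex^'k) \<Rightarrow> 'n set set \<Rightarrow> complex^'n \<Rightarrow> bool" where
  "KT_translated \<alpha> T b \<longleftrightarrow>
     (\<forall>L\<in>T. (\<Inter>p\<in>L. hyp \<alpha> b p) \<noteq> {} \<and>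
            (\<forall>t. t \<notin> L \<longrightarrow> (\<Inter>p\<in>L \<union> {t}. hyp \<alpha> b p) = {}))"

text \<open>The vertex \<open>P_L\<close> of the almost \<open>K_T\<close>-configuration.\<close>

definition almost_vertex ::
    "('n \<Rightarrow> complex^'k) \<Rightarrow> 'n \<Rightarrow> 'n set set \<Rightarrow> complex^'n \<Rightarrow> 'n set \<Rightarrow> (complex^'k) set" where
  "almost_vertex \<alpha> l S b L = (\<Inter>p\<in>(if L \<in> S then L - {l} else L). hyp \<alpha> b p)"

text \<open>
  ``\<open>K_T\<close> but for the hyperplane \<open>H_l\<close> and the set \<open>S_l\<close>'': as for \<open>K_T\<close>-translates, no
  hyperplane \<open>H_t\<close> with \<open>t \<notin> L\<close> passes through the vertex \<open>P_L\<close> (last clause). Without this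
  clause, the translates in which all \<open>H_p\<close> with \<open>p \<noteq> l\<close> share a point would be
  almost \<open>K_T\<close>, although no translation of \<open>H_l\<close> makes them \<open>K_T\<close>.
\<close>

definition almost_KT ::
    "('n \<Rightarrow> complex^'k) \<Rightarrow> 'n set set \<Rightarrow> 'n \<Rightarrow> 'n set set \<Rightarrow> complex^'n \<Rightarrow> bool" where
  "almost_KT \<alpha> T l S b \<longleftrightarrow>
     (\<forall>L\<in>T - S. (\<Inter>p\<in>L. hyp \<alpha> b p) \<noteq> {}) \<and>
     (\<forall>L\<in>S. (\<Inter>p\<in>L. hyp \<alpha> b p) = {}) \<and>
     (\<forall>L\<in>T. \<forall>t. t \<notin> L \<longrightarrow> almost_vertex \<alpha> l S b L \<inter> hyp \<alpha> b t = {})"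

definition translate_hyp :: "'n \<Rightarrow> complex \<Rightarrow> complex^'n \<Rightarrow> complex^'n" where
  "translate_hyp l c b = (\<chi> p. if p = l then c else b $ p)"

text \<open>
  ``Any almost \<open>K_T\<close>-configuration gives rise to a \<open>K_T\<close>-configuration'' presupposes that there
  is an almost \<open>K_T\<close>-configuration. Otherwise, for \<open>k = 2\<close> and \<open>n = 4\<close>, the set \<open>T\<close> of all
  four triples would make every arrangement dependent.
\<close>

definition dependent_rs :: "('n::finite \<Rightarrow> complex^'k) \<Rightarrow> nat \<Rightarrow> nat \<Rightarrow> bool" where
  "dependent_rs \<alpha> r s \<longleftrightarrow>
     (\<exists>T l S. r_set CARD('k) r T \<and> l \<in> \<Union>T - \<Inter>T \<and> S \<subseteq> {L \<in> T. l \<in> L} \<and> card S = s \<and>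
        (\<exists>b. almost_KT \<alpha> T l S b) \<and>
        (\<forall>b. almost_KT \<alpha> T l S b \<longrightarrow> (\<exists>c. KT_translated \<alpha> T (translate_hyp l c b))))"

end

theory Submission
  imports Defs
begin

text \<open>
  Take an \<open>r\<close>-set \<open>T\<close>, an index \<open>l\<close> and a set \<open>S\<close> of members of \<open>T\<close> through \<open>l\<close> that witness the
  dependency. The simple intersection is \<open>X = (\<Inter>L\<in>T. D \<alpha> L)\<close>.

  \<^bold>\<open>Simplicity\<close> needs a single \<open>K\<^sub>T\<close>-translate \<open>b'\<close>, a point of \<open>X\<close> that is as generic as the
  incidences in \<open>T\<close> allow. Suppose that the \<open>D \<alpha> L\<close> with \<open>L \<in> I\<close> meet in \<open>DS \<alpha> S'\<close>, where \<open>S'\<close> has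
  more than \<open>k + 1\<close> elements. Then \<open>DS \<alpha> S' \<subseteq> D \<alpha> L\<close>, which forces \<open>L \<subseteq> S'\<close>: a hyperplane with index
  outside \<open>S'\<close> can be moved without leaving \<open>DS \<alpha> S'\<close>. But then \<open>b' \<in> DS \<alpha> S'\<close> has some further
  hyperplane \<open>H\<^sub>t\<close> with \<open>t \<in> S' - L\<close> through the vertex \<open>P\<^sub>L\<close>, contrary to the definition of
  \<open>K\<^sub>T\<close>-translates (\<open>KT_translated_imp_simple\<close>).

  \<^bold>\<open>Rank.\<close> It suffices that one of the \<open>r\<close> hyperplanes is redundant, since \<open>X\<close> then has codimension
  at most \<open>r - 1\<close> (\<open>codim_Inter_D_le\<close>). Since \<open>s > 1\<close>, there are \<open>L \<noteq> L'\<close> in \<open>S\<close>, and \<open>D \<alpha> L\<close> is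
  redundant (\<open>dependent_imp_redundant\<close>): if \<open>v\<close> lies in all the other hyperplanes, then moving an
  almost \<open>K\<^sub>T\<close>-translate \<open>b\<close> in the direction of \<open>v\<close> by a suitable \<open>\<epsilon> \<noteq> 0\<close> yields another almost
  \<open>K\<^sub>T\<close>-translate. Both can be corrected by moving \<open>H\<^sub>l\<close> alone. As \<open>v \<in> D \<alpha> L'\<close>, the two corrections
  must be the same in order to bring both translates into \<open>D \<alpha> L'\<close>; and as they are the same, the
  difference \<open>\<epsilon> v\<close> of the corrected translates lies in \<open>D \<alpha> L\<close> too. In terms of equations: with two
  defects and only one free parameter \<open>H\<^sub>l\<close> to repair them, the defects must be proportional.
\<close>

section \<open>Linear algebra\<close>

text \<open>
  The hypothesis on \<open>e\<close> says that \<open>W\<close> and the line through \<open>e\<close> span the whole space. Any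
  \<open>u \<in> U - W\<close> can take the place of \<open>e\<close>, so that \<open>u\<close> and \<open>U \<inter> W\<close> span \<open>U\<close>.
\<close>

lemma dim_le_Suc_dim_Int_hyperplane:
  fixes U W :: "(complex^'n) set"
  assumes U: "vec.subspace U" and W: "vec.subspace W"
    and e: "\<And>b. \<exists>c. b - c *s e \<in> W"
  shows "vec.dim U \<le> Suc (vec.dim (U \<inter> W))"
proof (cases "U \<subseteq> W")
  case True
  then show ?thesis by (simp add: Int_absorb2)
next
  case False
  then obtain u where u: "u \<in> U" "u \<notin> W" by blast
  obtain a where a: "u - a *s e \<in> W" using e by blast
  have a0: "a \<noteq> 0" using a u by auto
  have "w \<in> vec.span (insert u (U \<inter> W))" if w: "w \<in> U" for w
  proof -
    obtain c where c: "w - c *s e \<in> W" using e by blast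
    have "w - (c / a) *s u = (w - c *s e) - (c / a) *s (u - a *s e)"
      using a0 by (simp add: vec_eq_iff field_simps)
    then have "w - (c / a) *s u \<in> W"
      using W a c by (simp only: vec.subspace_diff vec.subspace_scale)
    moreover have "w - (c / a) *s u \<in> U"
      using U u w by (simp only: vec.subspace_diff vec.subspace_scale)
    ultimately show ?thesis
      unfolding vec.span_breakdown_eq by (blast intro: vec.span_base)
  qed
  then have "vec.dim U \<le> vec.dim (insert u (U \<inter> W))"
    by (intro vec.dim_mono) blast
  also have "\<dots> \<le> Suc (vec.dim (U \<inter> W))"
    by (simp add: vec.dim_insert)
  finally show ?thesis .
qed

lemma subspace_scale_cancel:
  fixes v :: "complex^'n"
  assumes "vec.subspace W" and "a \<noteq> 0" and "a *s v \<in> W"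
  shows "v \<in> W"
  using vec.subspace_scale[OF assms(1,3), of "inverse a"] \<open>a \<noteq> 0\<close> by simp

text \<open>
  A line through a point outside a subspace meets that subspace at most once, so finitely many
  subspaces exclude only finitely many parameters.
\<close>

lemma perturb_avoiding_subspaces:
  fixes b v :: "complex^'n"
  assumes "finite F" and W: "\<And>W. W \<in> F \<Longrightarrow> vec.subspace W \<and> b \<notin> W"
  obtains c where "c \<noteq> 0" and "\<And>W. W \<in> F \<Longrightarrow> b + c *s v \<notin> W"
proof -
  have "finite {c. b + c *s v \<in> W}" if "W \<in> F" for W
  proof -
    have sub: "vec.subspace W" and b: "b \<notin> W" using W[OF that] by auto
    have "c = d" if c: "b + c *s v \<in> W" and d: "b + d *s v \<in> W" for c d
    proof (rule ccontr)
      assume "c \<noteq> d"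
      have "(b + c *s v) - (b + d *s v) \<in> W"
        by (intro vec.subspace_diff sub c d)
      moreover have "(b + c *s v) - (b + d *s v) = (c - d) *s v"
        by (simp add: vec.scale_left_diff_distrib)
      ultimately have "(c - d) *s v \<in> W" by metis
      then have "v \<in> W"
        using subspace_scale_cancel[OF sub, of "c - d" v] \<open>c \<noteq> d\<close> by simp
      then have "(b + c *s v) - c *s v \<in> W"
        by (intro vec.subspace_diff vec.subspace_scale sub c)
      then have "b \<in> W" by simp
      with b show False by simp
    qed
    then have "{c. b + c *s v \<in> W} \<subseteq> {SOME c. b + c *s v \<in> W}"
      by (auto intro: someI2)
    then show ?thesis by (rule finite_subset) simp
  qed
  then have "finite (insert 0 (\<Union>W\<in>F. {c. b + c *s v \<in> W}))"
    using \<open>finite F\<close> by auto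
  then obtain c where "c \<notin> insert 0 (\<Union>W\<in>F. {c. b + c *s v \<in> W})"
    using ex_new_if_finite[OF infinite_UNIV_char_0] by blast
  then show thesis using that by auto
qed

section \<open>The subspaces of translates with a common point\<close>

lemma mem_D_iff: "b \<in> D \<alpha> L \<longleftrightarrow> (\<exists>x. \<forall>p\<in>L. (\<Sum>j\<in>UNIV. \<alpha> p $ j * x $ j) = b $ p)"
  by (auto simp: D_def hyp_def)

lemma subspace_D: "vec.subspace (D \<alpha> L)"
  unfolding vec.subspace_def
proof (intro conjI ballI allI)
  show "0 \<in> D \<alpha> L"
    unfolding mem_D_iff by (rule exI[of _ 0]) simp
next
  fix b c assume "b \<in> D \<alpha> L" "c \<in> D \<alpha> L"
  then obtain x y where "\<forall>p\<in>L. (\<Sum>j\<in>UNIV. \<alpha> p $ j * x $ j) = b $ p"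
    "\<forall>p\<in>L. (\<Sum>j\<in>UNIV. \<alpha> p $ j * y $ j) = c $ p"
    unfolding mem_D_iff by blast
  then show "b + c \<in> D \<alpha> L"
    unfolding mem_D_iff
    by (intro exI[of _ "x + y"]) (simp add: distrib_left sum.distrib)
next
  fix a b assume "b \<in> D \<alpha> L"
  then obtain x where "\<forall>p\<in>L. (\<Sum>j\<in>UNIV. \<alpha> p $ j * x $ j) = b $ p"
    unfolding mem_D_iff by blast
  then show "a *s b \<in> D \<alpha> L"
    unfolding mem_D_iff
    by (intro exI[of _ "a *s x"]) (simp add: mult.left_commute flip: sum_distrib_left)
qed

lemma D_antimono: "L \<subseteq> M \<Longrightarrow> D \<alpha> M \<subseteq> D \<alpha> L"
  unfolding D_def by blast

lemma translate_hyp_eq: "translate_hyp l c b = b + (c - b $ l) *s axis l 1"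
  by (simp add: translate_hyp_def vec_eq_iff axis_def)

text \<open>
  Any \<open>k\<close> normals of a generic arrangement form a basis, so any \<open>k\<close> of the translated hyperplanes
  meet in exactly one point. This makes each \<open>D \<alpha> L\<close> with \<open>k + 1\<close> indices a hyperplane: every
  translate enters it after moving any one \<open>H\<^sub>p\<close>, \<open>p \<in> L\<close>, by a unique amount.
\<close>

context
  fixes \<alpha> :: "'n::finite \<Rightarrow> complex^'k"
  assumes gen: "central_generic \<alpha>"
begin

lemma generic_normals_separate:
  assumes M: "card M = CARD('k)" and x: "\<And>p. p \<in> M \<Longrightarrow> (\<Sum>j\<in>UNIV. \<alpha> p $ j * x $ j) = 0"
  shows "x = 0"
proof -
  have "vec.dim (\<Inter>p\<in>M. hyp \<alpha> 0 p) = CARD('k) - card M"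
    using gen M unfolding central_generic_def by (metis order_refl)
  then have "(\<Inter>p\<in>M. hyp \<alpha> 0 p) \<subseteq> {0}"
    using M by simp
  moreover have "x \<in> (\<Inter>p\<in>M. hyp \<alpha> 0 p)" using x by (simp add: hyp_def)
  ultimately show ?thesis by blast
qed

lemma generic_point_unique:
  assumes M: "card M = CARD('k)"
    and x: "\<And>p. p \<in> M \<Longrightarrow> (\<Sum>j\<in>UNIV. \<alpha> p $ j * x $ j) = c p"
    and y: "\<And>p. p \<in> M \<Longrightarrow> (\<Sum>j\<in>UNIV. \<alpha> p $ j * y $ j) = c p"
  shows "x = y"
proof -
  have "x - y = 0"
    by (rule generic_normals_separate[OF M]) (simp add: x y right_diff_distrib sum_subtractf)
  then show ?thesis by simp
qed

lemma generic_point_exists: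
  assumes M: "card M = CARD('k)"
  obtains x where "\<And>p. p \<in> M \<Longrightarrow> (\<Sum>j\<in>UNIV. \<alpha> p $ j * x $ j) = c p"
proof -
  obtain f :: "'k \<Rightarrow> 'n" where f: "bij_betw f UNIV M"
    using finite_same_card_bij[of "UNIV :: 'k set" M] M by auto
  define A :: "complex^'k^'k" where "A = (\<chi> i. \<alpha> (f i))"
  have A: "(A *v x) $ i = (\<Sum>j\<in>UNIV. \<alpha> (f i) $ j * x $ j)" for x i
    by (simp add: A_def matrix_vector_mult_def)
  have "x = 0" if "A *v x = 0" for x
  proof (rule generic_normals_separate[OF M])
    fix p assume "p \<in> M"
    then obtain i where "p = f i" using f by (auto simp: bij_betw_def)
    then show "(\<Sum>j\<in>UNIV. \<alpha> p $ j * x $ j) = 0" using that A[of x i] by simp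
  qed
  then obtain B where "B ** A = mat 1"
    using matrix_left_invertible_ker by blast
  then have AB: "A ** B = mat 1" by (simp add: matrix_left_right_inverse)
  have sol: "A *v (B *v (\<chi> i. c (f i))) = (\<chi> i. c (f i))"
    by (simp add: matrix_vector_mul_assoc AB)
  show thesis
  proof (rule that)
    fix p assume "p \<in> M"
    then obtain i where "p = f i" using f by (auto simp: bij_betw_def)
    then show "(\<Sum>j\<in>UNIV. \<alpha> p $ j * (B *v (\<chi> i. c (f i))) $ j) = c p"
      using sol by (simp flip: A)
  qed
qed

text \<open>
  In the translate \<open>axis p 1\<close>, the \<open>k\<close> hyperplanes of \<open>L - {p}\<close> still meet only in the origin, which
  \<open>H\<^sub>p\<close> has left.
\<close>

lemma axis_notin_D:
  assumes L: "card L = CARD('k) + 1" and p: "p \<in> L"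
  shows "axis p 1 \<notin> D \<alpha> L"
proof
  assume "axis p 1 \<in> D \<alpha> L"
  then obtain x where x: "\<And>q. q \<in> L \<Longrightarrow> (\<Sum>j\<in>UNIV. \<alpha> q $ j * x $ j) = axis p 1 $ q"
    unfolding mem_D_iff by blast
  have "card (L - {p}) = CARD('k)" using L p by simp
  then have "x = 0"
    by (rule generic_normals_separate) (simp add: x axis_def)
  then show False using x[OF p] by simp
qed

lemma translate_one_into_D:
  assumes L: "card L = CARD('k) + 1" and p: "p \<in> L"
  shows "\<exists>c. b - c *s axis p 1 \<in> D \<alpha> L"
proof -
  have M: "card (L - {p}) = CARD('k)" using L p by simp
  obtain x where x: "\<And>q. q \<in> L - {p} \<Longrightarrow> (\<Sum>j\<in>UNIV. \<alpha> q $ j * x $ j) = b $ q"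
    using generic_point_exists[OF M] by metis
  have "b - (b $ p - (\<Sum>j\<in>UNIV. \<alpha> p $ j * x $ j)) *s axis p 1 \<in> D \<alpha> L"
    unfolding mem_D_iff
    by (rule exI[of _ x]) (auto simp: x axis_def)
  then show ?thesis by blast
qed

lemma codim_Inter_D_le:
  assumes "finite T" and "\<And>L. L \<in> T \<Longrightarrow> card L = CARD('k) + 1"
  shows "CARD('n) \<le> vec.dim (\<Inter>L\<in>T. D \<alpha> L) + card T"
  using assms
proof (induction T)
  case empty
  then show ?case by (simp add: vec.dim_UNIV card_cart_basis)
next
  case (insert L T)
  have L: "card L = CARD('k) + 1" using insert.prems by simp
  then obtain p where p: "p \<in> L" by fastforce
  have "vec.subspace (\<Inter>L\<in>T. D \<alpha> L)"
    by (auto intro: vec.subspace_Int subspace_D)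
  then have "vec.dim (\<Inter>L\<in>T. D \<alpha> L) \<le> Suc (vec.dim ((\<Inter>L\<in>T. D \<alpha> L) \<inter> D \<alpha> L))"
    using subspace_D translate_one_into_D[OF L p] by (rule dim_le_Suc_dim_Int_hyperplane)
  then show ?case using insert by (simp add: Int_commute)
qed

section \<open>Simplicity\<close>

text \<open>
  Moving \<open>H\<^sub>p\<close> alone with \<open>p \<in> L - S\<close> leaves the central arrangement inside \<open>DS \<alpha> S\<close> but takes it out
  of \<open>D \<alpha> L\<close>.
\<close>

lemma DS_subset_D_imp_subset:
  assumes L: "card L = CARD('k) + 1" and sub: "DS \<alpha> S \<subseteq> D \<alpha> L"
  shows "L \<subseteq> S"
proof
  fix p assume p: "p \<in> L"
  show "p \<in> S"
  proof (rule ccontr)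
    assume "p \<notin> S"
    then have "axis p 1 \<in> D \<alpha> S"
      unfolding mem_D_iff by (intro exI[of _ 0]) (auto simp: axis_def)
    then have "axis p 1 \<in> DS \<alpha> S"
      using D_antimono unfolding DS_def by blast
    then show False using sub axis_notin_D[OF L p] by blast
  qed
qed

text \<open>
  The definition of \<open>DS\<close> provides common points only for \<open>k + 1\<close> hyperplanes at a time. The point for
  \<open>L\<close> and the one for \<open>L\<close> with some \<open>p\<close> exchanged for \<open>t\<close> both lie on the \<open>k\<close> hyperplanes of
  \<open>L - {p}\<close>, hence they coincide.
\<close>

lemma DS_common_point:
  assumes b: "b \<in> DS \<alpha> S" and L: "L \<subseteq> S" "card L = CARD('k) + 1" and t: "t \<in> S"
  shows "b \<in> D \<alpha> (insert t L)"
proof (cases "t \<in> L")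
  case True
  then show ?thesis using b L by (auto simp: DS_def insert_absorb)
next
  case False
  obtain p where p: "p \<in> L" using L by fastforce
  define M where "M = L - {p}"
  have M: "card M = CARD('k)" using L p by (simp add: M_def)
  have "card (insert t M) = CARD('k) + 1" using M False by (simp add: M_def)
  then have "b \<in> D \<alpha> L" "b \<in> D \<alpha> (insert t M)"
    using b L t unfolding DS_def M_def by blast+
  then obtain x y where x: "\<And>q. q \<in> L \<Longrightarrow> (\<Sum>j\<in>UNIV. \<alpha> q $ j * x $ j) = b $ q"
    and y: "\<And>q. q \<in> insert t M \<Longrightarrow> (\<Sum>j\<in>UNIV. \<alpha> q $ j * y $ j) = b $ q"
    unfolding mem_D_iff by blast
  have "x = y"
    by (rule generic_point_unique[OF M]) (auto simp: x y M_def)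
  then show ?thesis unfolding mem_D_iff using x y by blast
qed

lemma KT_translated_imp_simple:
  assumes card: "\<And>L. L \<in> T \<Longrightarrow> card L = CARD('k) + 1" and KT: "KT_translated \<alpha> T b"
  shows "simple_intersection \<alpha> (card T) (\<Inter>L\<in>T. D \<alpha> L)"
proof -
  have "(\<Inter>L\<in>I. D \<alpha> L) \<noteq> DS \<alpha> S"
    if I: "I \<subseteq> T" "card I \<ge> 2" and S: "card S > CARD('k) + 1" for I S
  proof
    assume eq: "(\<Inter>L\<in>I. D \<alpha> L) = DS \<alpha> S"
    obtain L where L: "L \<in> I" using I by fastforce
    have cL: "card L = CARD('k) + 1" and "L \<in> T" using card I L by auto
    have LS: "L \<subseteq> S" using DS_subset_D_imp_subset[OF cL] eq L by blast
    then obtain t where t: "t \<in> S" "t \<notin> L"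
      using cL S by (metis nat_less_le subsetI subset_antisym)
    have "b \<in> (\<Inter>L\<in>I. D \<alpha> L)" using KT I by (auto simp: KT_translated_def D_def)
    then have "b \<in> D \<alpha> (insert t L)" using DS_common_point[OF _ LS cL t(1)] eq by simp
    then show False using KT \<open>L \<in> T\<close> t by (auto simp: KT_translated_def D_def)
  qed
  moreover have "(\<Inter>L\<in>T. D \<alpha> L) \<in> intersection_lattice (discriminantal \<alpha>)"
    unfolding intersection_lattice_def discriminantal_def
    using card by (intro CollectI exI[of _ "D \<alpha> ` T"]) auto
  ultimately show ?thesis unfolding simple_intersection_def using card by blast
qed

section \<open>Dependence\<close>

text \<open>
  Every clause of the definition is membership or non-membership in a subspace of translates, which
  is what makes the notion stable under the perturbations below.
\<close>

lemma almost_KT_iff: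
  "almost_KT \<alpha> T l S b \<longleftrightarrow>
     (\<forall>L\<in>T - S. b \<in> D \<alpha> L) \<and> (\<forall>L\<in>S. b \<notin> D \<alpha> L) \<and>
     (\<forall>L\<in>T. \<forall>t. t \<notin> L \<longrightarrow> b \<notin> D \<alpha> (insert t (if L \<in> S then L - {l} else L)))"
  unfolding almost_KT_def D_def almost_vertex_def by (simp add: Int_commute)

lemma KT_translated_imp_mem_D: "KT_translated \<alpha> T b \<Longrightarrow> L \<in> T \<Longrightarrow> b \<in> D \<alpha> L"
  by (simp add: KT_translated_def D_def)

text \<open>
  The closed conditions of an almost \<open>K\<^sub>T\<close>-translate persist because \<open>v\<close> is chosen inside the relevant
  subspaces; the open ones exclude finitely many proper subspaces.
\<close>

lemma almost_KT_perturb: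
  assumes b: "almost_KT \<alpha> T l S b" and v: "\<And>L. L \<in> T - S \<Longrightarrow> v \<in> D \<alpha> L"
  obtains c where "c \<noteq> 0" and "almost_KT \<alpha> T l S (b + c *s v)"
proof -
  define F where "F = D \<alpha> ` {L. b \<notin> D \<alpha> L}"
  have "finite F" by (simp add: F_def)
  moreover have "vec.subspace W \<and> b \<notin> W" if "W \<in> F" for W
    using that by (auto simp: F_def subspace_D)
  ultimately obtain c where c: "c \<noteq> 0" "\<And>W. W \<in> F \<Longrightarrow> b + c *s v \<notin> W"
    using perturb_avoiding_subspaces by metis
  have avoid: "b + c *s v \<notin> D \<alpha> L" if "b \<notin> D \<alpha> L" for L
    using c(2) that by (auto simp: F_def)
  have "b + c *s v \<in> D \<alpha> L" if "L \<in> T - S" for L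
    using b v that subspace_D
    by (auto simp: almost_KT_iff intro!: vec.subspace_add vec.subspace_scale)
  then have "almost_KT \<alpha> T l S (b + c *s v)"
    using b avoid by (simp add: almost_KT_iff)
  then show thesis using that c(1) by blast
qed

text \<open>
  The argument compares the corrections of \<open>b\<close> and \<open>b + \<epsilon> v\<close>. The second set \<open>L'\<close> is what determines the
  correction: \<open>v\<close> does not change the defect at \<open>L'\<close>, and since \<open>l \<in> L'\<close> only one position of \<open>H\<^sub>l\<close>
  repairs it.
\<close>

lemma dependent_imp_redundant:
  assumes card: "\<And>L. L \<in> T \<Longrightarrow> card L = CARD('k) + 1"
    and S: "S \<subseteq> {L \<in> T. l \<in> L}"
    and b: "almost_KT \<alpha> T l S b"
    and dep: "\<And>b. almost_KT \<alpha> T l S b \<Longrightarrow> \<exists>c. KT_translated \<alpha> T (translate_hyp l c b)"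
    and L: "L \<in> S" "L' \<in> S" "L \<noteq> L'"
  shows "(\<Inter>L\<in>T. D \<alpha> L) = (\<Inter>L\<in>T - {L}. D \<alpha> L)"
proof
  show "(\<Inter>L\<in>T - {L}. D \<alpha> L) \<subseteq> (\<Inter>L\<in>T. D \<alpha> L)"
  proof
    fix v assume v: "v \<in> (\<Inter>L\<in>T - {L}. D \<alpha> L)"
    have LT: "L \<in> T" "L' \<in> T" "l \<in> L'" using L S by auto
    have "v \<in> D \<alpha> K" if "K \<in> T - S" for K using v that L by blast
    then obtain \<epsilon> where \<epsilon>: "\<epsilon> \<noteq> 0" "almost_KT \<alpha> T l S (b + \<epsilon> *s v)"
      using almost_KT_perturb[OF b] by blast
    obtain c d where
      c: "KT_translated \<alpha> T (translate_hyp l c b)" and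
      d: "KT_translated \<alpha> T (translate_hyp l d (b + \<epsilon> *s v))"
      using dep[OF b] dep[OF \<epsilon>(2)] by blast
    \<comment> \<open>how much further \<open>H\<^sub>l\<close> has to move for \<open>b + \<epsilon> v\<close> than for \<open>b\<close>\<close>
    define \<mu> where "\<mu> = (d - (b + \<epsilon> *s v) $ l) - (c - b $ l)"
    have "translate_hyp l d (b + \<epsilon> *s v) - translate_hyp l c b = \<epsilon> *s v + \<mu> *s axis l 1"
      unfolding translate_hyp_eq \<mu>_def by (simp only: vec.scale_left_diff_distrib) simp
    then have diff: "\<epsilon> *s v + \<mu> *s axis l 1 \<in> D \<alpha> K" if "K \<in> T" for K
      using vec.subspace_diff[OF subspace_D
          KT_translated_imp_mem_D[OF d that] KT_translated_imp_mem_D[OF c that]] by simp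
    have "\<epsilon> *s v \<in> D \<alpha> L'" using v LT L by (auto intro!: vec.subspace_scale subspace_D)
    then have "(\<epsilon> *s v + \<mu> *s axis l 1) - \<epsilon> *s v \<in> D \<alpha> L'"
      by (intro vec.subspace_diff subspace_D diff LT)
    then have "\<mu> *s axis l 1 \<in> D \<alpha> L'" by simp
    then have "\<mu> = 0"
      using subspace_scale_cancel[OF subspace_D] axis_notin_D[OF card[OF LT(2)] LT(3)] by blast
    then have "\<epsilon> *s v \<in> D \<alpha> L" using diff[OF LT(1)] by simp
    then have "v \<in> D \<alpha> L" using subspace_scale_cancel[OF subspace_D \<epsilon>(1)] by blast
    then show "v \<in> (\<Inter>L\<in>T. D \<alpha> L)" using v by blast
  qed
qed auto

end

theorem lemma3p7:
  fixes \<alpha> :: "'n::finite \<Rightarrow> complex^'k" and r s :: nat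
  assumes "CARD('n) > CARD('k)" and "CARD('k) \<ge> 2"
    and "central_generic \<alpha>"
    and "s > 1" and "dependent_rs \<alpha> r s"
  shows "\<exists>X. simple_intersection \<alpha> r X \<and> rank_of X < r"
proof -
  note gen = \<open>central_generic \<alpha>\<close>
  obtain T l S b where "r_set CARD('k) r T"
    and S: "S \<subseteq> {L \<in> T. l \<in> L}" "card S = s"
    and b: "almost_KT \<alpha> T l S b"
    and dep: "\<And>b. almost_KT \<alpha> T l S b \<Longrightarrow> \<exists>c. KT_translated \<alpha> T (translate_hyp l c b)"
    using \<open>dependent_rs \<alpha> r s\<close> unfolding dependent_rs_def by blast
  then have T: "card T = r" "\<And>L. L \<in> T \<Longrightarrow> card L = CARD('k) + 1"
    by (auto simp: r_set_def)
  let ?X = "\<Inter>L\<in>T. D \<alpha> L"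
  obtain b' where "KT_translated \<alpha> T b'" using dep b by blast
  then have simple: "simple_intersection \<alpha> r ?X"
    using KT_translated_imp_simple[OF gen T(2)] T(1) by blast
  have "\<not> S \<subseteq> {L}" for L
    using S(2) \<open>s > 1\<close> card_mono[of "{L}" S] by auto
  then obtain L L' where L: "L \<in> S" "L' \<in> S" "L \<noteq> L'" by blast
  have "?X = (\<Inter>L\<in>T - {L}. D \<alpha> L)"
    using dependent_imp_redundant[OF gen T(2) S(1) b dep L] .
  moreover have "CARD('n) \<le> vec.dim (\<Inter>L\<in>T - {L}. D \<alpha> L) + card (T - {L})"
    by (rule codim_Inter_D_le[OF gen]) (simp_all add: T(2))
  moreover have "card (T - {L}) < r"
    using L S T(1) by (auto intro!: card_Diff1_less)
  ultimately have "rank_of ?X < r" unfolding rank_of_def by simp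
  with simple show ?thesis by blast
qed

end
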